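(* Let $\mathbb{Q}[E,L]=\mathbb{Q}[E_{10},E_{20},E_{30},E_{01},E_{02},E_{03},E_{21},E_{11},E_{12},L]$ and let $K\subset\mathbb{Q}[E,L]$ be the kernel of the substitution homomorphism $\varphi$ described in the context. Consider the following system of polynomial equations for a point $(E_{10},E_{20},E_{30},E_{01},E_{02},E_{03},E_{21},E_{11},E_{12},L)\in\mathbb{R}^{10}$: $$E_{10}^2-2E_{20}-L^2=0,\qquad 2E_{02}-4E_{20}-E_{01}^2+2E_{10}^2=0,$$ $$E_{10}E_{11}-3E_{03}-E_{21}+3E_{01}E_{02}-E_{20}E_{01}-E_{01}^3=0,$$ $$E_{01}E_{11}-E_{12}-3E_{30}+E_{10}E_{02}+E_{20}E_{10}-E_{01}^2E_{10}=0,$$ $$-E_{10}E_{21}-E_{01}E_{12}-E_{01}E_{30}-E_{01}^3E_{10}+E_{01}^2E_{11}-E_{02}E_{11}+E_{11}E_{20}-E_{10}E_{03}+2E_{10}E_{01}E_{02}=0,$$ $$4E_{01}E_{10}E_{11}-3E_{01}^2E_{10}^2+2E_{10}^2E_{02}+2E_{20}E_{01}^2-2E_{10}E_{12}-2E_{02}E_{20}-2E_{01}E_{21}-E_{11}^2-12E_{10}E_{30}+6E_{20}^2=0,$$ $$4E_{01}E_{10}E_{11}-4E_{10}^2E_{02}-4E_{20}E_{01}^2-2E_{10}E_{12}+10E_{02}E_{20}-2E_{01}E_{21}-E_{11}^2-12E_{01}E_{03}-3E_{01}^4-6E_{02}^2+12E_{01}^2E_{02}=0,$$ $$\begin{ali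gned}&9E_{01}E_{03}E_{20}-7E_{01}^2E_{02}E_{20}+2E_{02}E_{10}E_{12}-2E_{01}^2E_{10}E_{12}+3E_{03}E_{10}E_{11}+4E_{01}^3E_{10}E_{11}\\&-7E_{01}E_{02}E_{10}E_{11}-6E_{01}E_{03}E_{10}^2+8E_{01}^2E_{02}E_{10}^2+3E_{01}E_{11}E_{30}-2E_{01}E_{20}E_{21}+E_{10}E_{12}E_{20}\\&-E_{02}E_{10}^2E_{20}+E_{01}E_{10}E_{11}E_{20}+9E_{02}E_{10}E_{30}-2E_{02}E_{20}^2+2E_{01}^2E_{20}^2-E_{11}^2E_{20}-3E_{12}E_{30}\\&+E_{02}E_{11}^2-E_{01}^2E_{11}^2-2E_{02}^2E_{10}^2+2E_{01}^4E_{20}+2E_{02}^2E_{20}-3E_{03}E_{21}-2E_{01}^3E_{21}\\&+5E_{01}E_{02}E_{21}-6E_{01}^2E_{10}E_{30}-3E_{01}^4E_{10}^2=0,\end{aligned}$$ together with the kernel equations $q(E_{10},\dots,E_{12},L)=0$ for all $q\in K$. Then for points of $\mathbb{R}^{10}$ with $E_{10}\neq 0$ or $E_{01}\neq 0$, this system is equivalent to the single equation $$4E_{11}^2+E_{10}^4+E_{01}^4-2E_{10}^2E_{01}^2-2L^2E_{10}^2-6E_{01}^2L^2+L^4=0$$ in the following sense: such a point satisfies the whole system if and only if $(E_{10},E_{01},E_{11},L)$ satisfies the displayed single equation and the remaining coordinates are determined by $$E_{20}=\tfrac12E_{10}^2-\tfrac12L^2,\qquad E_{02}=\tfrac12E_{01}^2-L^2,$$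 $$E_{03}=-\tfrac13E_{21}-\tfrac16E_{01}E_{10}^2-\tfrac56E_{01}L^2+\tfrac16E_{01}^3+\tfrac13E_{10}E_{11},$$ $$E_{30}=-\tfrac13E_{12}-\tfrac16E_{10}E_{01}^2-\tfrac12E_{10}L^2+\tfrac16E_{10}^3+\tfrac13E_{01}E_{11},$$ and $(E_{21},E_{12})$ being the unique solution of the linear system $$E_{10}E_{21}+E_{01}E_{12}=\tfrac14E_{11}E_{10}^2+\tfrac14E_{01}^2E_{11}+\tfrac34E_{11}L^2-E_{10}E_{01}L^2,$$ $$-E_{01}E_{21}+E_{10}E_{12}=\tfrac18E_{10}^4-\tfrac18E_{01}^4-\tfrac34E_{10}^2L^2+E_{01}^2L^2-\tfrac38L^4.$$
   Context: Let $\varphi:\mathbb{Q}[E_{10},E_{20},E_{30},E_{01},E_{02},E_{03},E_{21},E_{11},E_{12},L]\to\mathbb{Q}[x_1,x_2,x_3,d_1,d_2,d_3,L]$ be the ring homomorphism fixing $L$ and sending $E_{10}\mapsto x_1+x_2+x_3$, $E_{20}\mapsto x_1x_2+x_2x_3+x_3x_1$, $E_{30}\mapsto x_1x_2x_3$, $E_{01}\mapsto d_1+d_2+d_3$, $E_{02}\mapsto d_1d_2+d_2d_3+d_3d_1$, $E_{03}\mapsto d_1d_2d_3$, $E_{21}\mapsto x_1x_2d_3+x_2x_3d_1+x_3x_1d_2$, $E_{11}\mapsto x_1d_2+d_1x_2+x_2d_3+d_2x_3+x_3d_1+d_3x_1$, $E_{12}\mapsto x_1d_2d_3+x_2d_3d_1+x_3d_1d_2$.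 $K=\ker\varphi$ (a finitely generated ideal; the kernel equations are $q=0$ for its elements, equivalently for a finite generating set). The first eight displayed equations are, up to nonzero constant factors, preimages under $\varphi$ of the symmetric polynomials $\sum x_i^2-L^2$, $\sum_i p_i$, $\sum_i d_ip_i$, $\sum_i x_ip_i$, $\sum_i x_id_ip_i$, $\sum_i x_i^2p_i$, $\sum_i d_i^2p_i$, $\sum_i x_i^2d_i^2p_i$, where $p_1=x_2^2+x_3^2-d_1^2$, $p_2=x_3^2+x_1^2-d_2^2$, $p_3=x_1^2+x_2^2-d_3^2$ (the perfect cuboid factor equations). *)

theory Defs
  imports Complex_Main "HOL-Library.Poly_Mapping"
begin

text \<open>
  Multivariate polynomials over the rationals with variables indexed by \<open>'v\<close>: finitely supported
  maps from exponent vectors to coefficients, with the convolution product of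
  \<open>HOL-Library.Poly_Mapping\<close>.
\<close>

type_synonym 'v rat_mpoly = "('v \<Rightarrow>\<^sub>0 nat) \<Rightarrow>\<^sub>0 rat"

definition Const :: "rat \<Rightarrow> 'v rat_mpoly" where
  "Const c = Poly_Mapping.single 0 c"

definition Var :: "'v \<Rightarrow> 'v rat_mpoly" where
  "Var v = Poly_Mapping.single (Poly_Mapping.single v 1) 1"

definition eval_monom :: "('v \<Rightarrow> 'b::comm_ring_1) \<Rightarrow> ('v \<Rightarrow>\<^sub>0 nat) \<Rightarrow> 'b" where
  "eval_monom f m = (\<Prod>v\<in>Poly_Mapping.keys m. f v ^ Poly_Mapping.lookup m v)"

text \<open>
  The extension of a coefficient map \<open>h\<close> and an assignment \<open>f\<close> of the variables to all polynomials.
  With \<open>h = Const\<close> this is substitution of polynomials for the variables, with \<open>h = of_rat\<close> it is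
  evaluation at a real point. If \<open>h\<close> is a ring homomorphism, then so is the extension,
  by the lemmas below.
\<close>

definition poly_subst :: "(rat \<Rightarrow> 'b::comm_ring_1) \<Rightarrow> ('v \<Rightarrow> 'b) \<Rightarrow> 'v rat_mpoly \<Rightarrow> 'b" where
  "poly_subst h f p =
     (\<Sum>m\<in>Poly_Mapping.keys p. h (Poly_Mapping.lookup p m) * eval_monom f m)"

lemma eval_monom_superset:
  assumes "finite A" "Poly_Mapping.keys m \<subseteq> A"
  shows "eval_monom f m = (\<Prod>v\<in>A. f v ^ Poly_Mapping.lookup m v)"
  unfolding eval_monom_def
  by (rule prod.mono_neutral_left) (use assms in \<open>auto simp: in_keys_iff\<close>)

lemma eval_monom_add: "eval_monom f (m + n) = eval_monom f m * eval_monom f n"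
proof -
  let ?A = "Poly_Mapping.keys m \<union> Poly_Mapping.keys n"
  have fin: "finite ?A" by simp
  have "eval_monom f (m + n) = (\<Prod>v\<in>?A. f v ^ Poly_Mapping.lookup (m + n) v)"
    by (rule eval_monom_superset[OF fin keys_add])
  also have "\<dots> = (\<Prod>v\<in>?A. f v ^ Poly_Mapping.lookup m v) * (\<Prod>v\<in>?A. f v ^ Poly_Mapping.lookup n v)"
    by (simp add: lookup_add power_add prod.distrib)
  also have "\<dots> = eval_monom f m * eval_monom f n"
    using eval_monom_superset[OF fin, of m f] eval_monom_superset[OF fin, of n f] by simp
  finally show ?thesis .
qed

lemma poly_subst_superset:
  assumes "h 0 = 0" "finite A" "Poly_Mapping.keys p \<subseteq> A"
  shows "poly_subst h f p = (\<Sum>m\<in>A. h (Poly_Mapping.lookup p m) * eval_monom f m)"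
  unfolding poly_subst_def
  by (rule sum.mono_neutral_left) (use assms in \<open>auto simp: in_keys_iff\<close>)

lemma poly_subst_single:
  assumes "h 0 = 0"
  shows "poly_subst h f (Poly_Mapping.single m c) = h c * eval_monom f m"
  using poly_subst_superset[where h = h, OF assms, where A = "{m}" and p = "Poly_Mapping.single m c" and f = f] by simp

lemma poly_subst_Const:
  assumes "h 0 = 0"
  shows "poly_subst h f (Const c) = h c"
  by (simp add: Const_def poly_subst_single assms eval_monom_def)

lemma poly_subst_Var:
  assumes "h 0 = 0" "h 1 = 1"
  shows "poly_subst h f (Var v) = f v"
  by (simp add: Var_def poly_subst_single assms eval_monom_def)

lemma poly_subst_add:
  assumes "h 0 = 0" "\<And>a b. h (a + b) = h a + h b"
  shows "poly_subst h f (p + q) = poly_subst h f p + poly_subst h f q"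
proof -
  let ?A = "Poly_Mapping.keys p \<union> Poly_Mapping.keys q"
  have fin: "finite ?A" by simp
  show ?thesis
    using poly_subst_superset[where h = h, OF assms(1) fin, of "p + q" f] keys_add[of p q]
      poly_subst_superset[where h = h, OF assms(1) fin, of p f] poly_subst_superset[where h = h, OF assms(1) fin, of q f]
    by (simp add: lookup_add assms(2) distrib_right sum.distrib)
qed

lemma poly_subst_sum:
  assumes "h 0 = 0" "\<And>a b. h (a + b) = h a + h b"
  shows "poly_subst h f (sum g A) = (\<Sum>i\<in>A. poly_subst h f (g i))"
proof (induction A rule: infinite_finite_induct)
  case (insert x F)
  then show ?case by (simp add: poly_subst_add[where h = h, OF assms])
qed (simp_all add: poly_subst_def)

lemma rat_mpoly_expansion:
  fixes p :: "'v rat_mpoly"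
  shows "p = (\<Sum>m\<in>Poly_Mapping.keys p. Poly_Mapping.single m (Poly_Mapping.lookup p m))"
  by (rule poly_mapping_eqI)
    (simp add: lookup_sum lookup_single when_def sum.delta in_keys_iff)

lemma poly_subst_mult:
  assumes "h 0 = 0" "\<And>a b. h (a + b) = h a + h b" "\<And>a b. h (a * b) = h a * h b"
  shows "poly_subst h f (p * q) = poly_subst h f p * poly_subst h f q"
proof -
  let ?l = Poly_Mapping.lookup and ?k = Poly_Mapping.keys
  have "p * q = (\<Sum>m\<in>?k p. \<Sum>n\<in>?k q. Poly_Mapping.single (m + n) (?l p m * ?l q n))"
    by (subst rat_mpoly_expansion[of p], subst rat_mpoly_expansion[of q])
      (simp add: sum_product mult_single)
  then have "poly_subst h f (p * q) =
      (\<Sum>m\<in>?k p. \<Sum>n\<in>?k q. h (?l p m * ?l q n) * eval_monom f (m + n))"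
    by (simp add: poly_subst_sum[where h = h, OF assms(1,2)] poly_subst_single[where h = h, OF assms(1)])
  also have "\<dots> = poly_subst h f p * poly_subst h f q"
    by (simp add: poly_subst_def sum_product assms(3) eval_monom_add mult_ac)
  finally show ?thesis .
qed

text \<open>
  The generators of the two polynomial rings. The real coordinates of a point carry the names
  \<open>E10, \<dots>, E12, L\<close>, so the corresponding formal variables are called \<open>V10, \<dots>, V12, VL\<close>.
\<close>

datatype evar = V10 | V20 | V30 | V01 | V02 | V03 | V21 | V11 | V12 | VL

datatype xvar = X1 | X2 | X3 | D1 | D2 | D3 | XL

primrec phi_var :: "evar \<Rightarrow> xvar rat_mpoly" where
  "phi_var V10 = Var X1 + Var X2 + Var X3"
| "phi_var V20 = Var X1 * Var X2 + Var X2 * Var X3 + Var X3 * Var X1"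
| "phi_var V30 = Var X1 * Var X2 * Var X3"
| "phi_var V01 = Var D1 + Var D2 + Var D3"
| "phi_var V02 = Var D1 * Var D2 + Var D2 * Var D3 + Var D3 * Var D1"
| "phi_var V03 = Var D1 * Var D2 * Var D3"
| "phi_var V21 = Var X1 * Var X2 * Var D3 + Var X2 * Var X3 * Var D1 + Var X3 * Var X1 * Var D2"
| "phi_var V11 = Var X1 * Var D2 + Var D1 * Var X2 + Var X2 * Var D3 + Var D2 * Var X3
                 + Var X3 * Var D1 + Var D3 * Var X1"
| "phi_var V12 = Var X1 * Var D2 * Var D3 + Var X2 * Var D3 * Var D1 + Var X3 * Var D1 * Var D2"
| "phi_var VL = Var XL"

definition phi :: "evar rat_mpoly \<Rightarrow> xvar rat_mpoly" where
  "phi = poly_subst Const phi_var"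

definition K :: "evar rat_mpoly set" where
  "K = {q. phi q = 0}"

primrec point ::
  "real \<Rightarrow> real \<Rightarrow> real \<Rightarrow> real \<Rightarrow> real \<Rightarrow> real \<Rightarrow> real \<Rightarrow> real \<Rightarrow> real \<Rightarrow> real \<Rightarrow> evar \<Rightarrow> real" where
  "point E10 E20 E30 E01 E02 E03 E21 E11 E12 L V10 = E10"
| "point E10 E20 E30 E01 E02 E03 E21 E11 E12 L V20 = E20"
| "point E10 E20 E30 E01 E02 E03 E21 E11 E12 L V30 = E30"
| "point E10 E20 E30 E01 E02 E03 E21 E11 E12 L V01 = E01"
| "point E10 E20 E30 E01 E02 E03 E21 E11 E12 L V02 = E02"
| "point E10 E20 E30 E01 E02 E03 E21 E11 E12 L V03 = E03"
| "point E10 E20 E30 E01 E02 E03 E21 E11 E12 L V21 = E21"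
| "point E10 E20 E30 E01 E02 E03 E21 E11 E12 L V11 = E11"
| "point E10 E20 E30 E01 E02 E03 E21 E11 E12 L V12 = E12"
| "point E10 E20 E30 E01 E02 E03 E21 E11 E12 L VL = L"

definition eval_at :: "(evar \<Rightarrow> real) \<Rightarrow> evar rat_mpoly \<Rightarrow> real" where
  "eval_at P = poly_subst of_rat P"

lemma Const_hom:
  "Const 0 = 0" "Const 1 = 1" "Const (a + b) = Const a + Const b"
  "Const (a * b) = Const a * Const b"
  by (simp_all add: Const_def single_add mult_single)

lemma phi_ring_hom:
  "phi (Const c) = Const c" "phi (Var v) = phi_var v"
  "phi (p + q) = phi p + phi q" "phi (p * q) = phi p * phi q"
  unfolding phi_def
  by (simp_all add: poly_subst_Const poly_subst_Var poly_subst_add poly_subst_mult Const_hom)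

lemma eval_at_ring_hom:
  "eval_at P (Const c) = of_rat c" "eval_at P (Var v) = P v"
  "eval_at P (p + q) = eval_at P p + eval_at P q" "eval_at P (p * q) = eval_at P p * eval_at P q"
  unfolding eval_at_def
  by (simp_all add: poly_subst_Const poly_subst_Var poly_subst_add poly_subst_mult
      of_rat_add of_rat_mult)

text \<open>The linear system for the pair \<open>(E21, E12)\<close>, with unknowns \<open>u\<close> and \<open>v\<close>.\<close>

definition linear_system :: "real \<Rightarrow> real \<Rightarrow> real \<Rightarrow> real \<Rightarrow> real \<times> real \<Rightarrow> bool" where
  "linear_system E10 E01 E11 L = (\<lambda>(u, v).
     E10 * u + E01 * v = 1/4 * E11 * E10^2 + 1/4 * E01^2 * E11 + 3/4 * E11 * L^2 - E10 * E01 * L^2 \<and>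
     - E01 * u + E10 * v =
       1/8 * E10^4 - 1/8 * E01^4 - 3/4 * E10^2 * L^2 + E01^2 * L^2 - 3/8 * L^4)"

end

theory Submission
  imports Defs "HOL-Computational_Algebra.Fundamental_Theorem_Algebra"
begin

text \<open>
  The first seven equations already give one direction by linear elimination; the single equation
  is a multiple of the sum of the sixth and the seventh after that elimination.

  For the converse, a real point satisfies the kernel equations as soon as it is the image of a
  complex point \<open>(x, d)\<close>. Put \<open>z\<^sub>k = d\<^sub>k + \<i> x\<^sub>k\<close> and \<open>w\<^sub>k = d\<^sub>k - \<i> x\<^sub>k\<close>. The cuboid
  equations \<open>x\<^sub>k\<^sup>2 + d\<^sub>k\<^sup>2 = L\<^sup>2\<close> become \<open>z\<^sub>k w\<^sub>k = L\<^sup>2\<close>, and reality of the point means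
  that the elementary symmetric functions of the \<open>w\<^sub>k\<close> are conjugate to those of the \<open>z\<^sub>k\<close>,
  which are \<open>s = E01 + \<i> E10\<close>, \<open>q = E02 - E20 + \<i> E11\<close>, \<open>e = E03 - E21 + \<i> (E12 - E30)\<close>.
  In these terms the single equation reads \<open>|q|\<^sup>2 = L\<^sup>2 |s|\<^sup>2\<close>, and the linear system reads
  \<open>e (cnj s) = L\<^sup>2 q\<close>; for \<open>L \<noteq> 0\<close> these are exactly what is needed for the roots of
  \<open>Z\<^sup>3 - s Z\<^sup>2 + q Z - e\<close> to be a suitable choice of the \<open>z\<^sub>k\<close>.
\<close>

section \<open>Substitution homomorphisms and the kernel equations\<close>

lemma poly_subst_hom:
  fixes g :: "'a::comm_ring_1 \<Rightarrow> 'b::comm_ring_1"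
  assumes "g 0 = 0" "g 1 = 1" "\<And>a b. g (a + b) = g a + g b" "\<And>a b. g (a * b) = g a * g b"
  shows "g (poly_subst h f p) = poly_subst (\<lambda>c. g (h c)) (\<lambda>v. g (f v)) p"
proof -
  have pw: "g (x ^ n) = g x ^ n" for x n by (induction n) (simp_all add: assms)
  have pr: "g (prod F A) = (\<Prod>i\<in>A. g (F i))" for F :: "'v \<Rightarrow> 'a" and A
    by (induction A rule: infinite_finite_induct) (simp_all add: assms)
  have sm: "g (sum F A) = (\<Sum>i\<in>A. g (F i))" for F :: "('v \<Rightarrow>\<^sub>0 nat) \<Rightarrow> 'a" and A
    by (induction A rule: infinite_finite_induct) (simp_all add: assms)
  show ?thesis by (simp add: poly_subst_def eval_monom_def sm pr pw assms)
qed

lemma of_real_of_rat_eq: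
  "of_real (of_rat r) = (of_rat r :: 'a::{real_algebra_1, field_char_0, real_div_algebra})"
  by (cases r) (simp add: Fract_of_int_quotient of_rat_divide)

text \<open>Evaluation at \<open>P\<close> factors through \<open>phi\<close>, which kills
  \<open>q\<close>. The preimage \<open>X\<close> may be complex, since \<open>of_real\<close> is
  injective.\<close>

lemma kernel_vanishes_at_image:
  fixes P :: "evar \<Rightarrow> real" and X :: "xvar \<Rightarrow> complex"
  assumes "\<And>v. poly_subst of_rat X (phi_var v) = of_real (P v)" "q \<in> K"
  shows "eval_at P q = 0"
proof -
  have "(of_real (eval_at P q) :: complex)
      = poly_subst of_rat (\<lambda>v. poly_subst of_rat X (phi_var v)) q"
    by (simp add: eval_at_def poly_subst_hom[where g = of_real] assms(1) of_real_of_rat_eq)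
  also have "\<dots> = poly_subst of_rat X (phi q)"
    unfolding phi_def
    by (subst poly_subst_hom[where g = "poly_subst of_rat X"])
      (simp_all add: poly_subst_Const poly_subst_add poly_subst_mult of_rat_add of_rat_mult
        poly_subst_def[of _ _ 0] poly_subst_Const[where c=1 and h=of_rat, unfolded Const_hom(2)])
  also have "\<dots> = 0" using assms(2) by (simp add: K_def poly_subst_def)
  finally show ?thesis by simp
qed

section \<open>Triples with prescribed elementary symmetric functions\<close>

lemma vieta_cubic:
  fixes s q e :: complex
  obtains z1 z2 z3 where "z1 + z2 + z3 = s" "z1*z2 + z2*z3 + z3*z1 = q" "z1*z2*z3 = e"
proof -
  obtain z1 where 1: "z1^3 - s*z1^2 + q*z1 - e = 0"
    using fundamental_theorem_of_algebra[of "[:-e, q, -s, 1:]"]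
    by (auto simp: constant_degree algebra_simps power2_eq_square power3_eq_cube)
  \<comment> \<open>This quadratic is the quotient of the cubic by \<open>Z - z1\<close>; the last
    root is then forced by the sum \<open>s\<close>.\<close>
  obtain z2 where 2: "z2^2 - (s - z1)*z2 + (q - z1*(s - z1)) = 0"
    using fundamental_theorem_of_algebra[of "[:q - z1*(s - z1), -(s - z1), 1:]"]
    by (auto simp: constant_degree algebra_simps power2_eq_square)
  define z3 where "z3 = s - z1 - z2"
  show thesis
  proof (rule that[of z1 z2 z3])
    show "z1 + z2 + z3 = s" by (simp add: z3_def)
    show "z1*z2 + z2*z3 + z3*z1 = q" using 2 unfolding z3_def by algebra
    show "z1*z2*z3 = e" using 1 2 unfolding z3_def by algebra
  qed
qed

lemma reciprocal_triples:
  fixes s t q r e f m :: complex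
  assumes nz: "s \<noteq> 0" "t \<noteq> 0" and qr0: "q = 0 \<longleftrightarrow> r = 0"
    and qr: "q * r = m * (s * t)" and e: "e * t = m * q" and f: "f * s = m * r"
  obtains z1 z2 z3 w1 w2 w3 where
    "z1*w1 = m" "z2*w2 = m" "z3*w3 = m"
    "z1 + z2 + z3 = s" "z1*z2 + z2*z3 + z3*z1 = q" "z1*z2*z3 = e"
    "w1 + w2 + w3 = t" "w1*w2 + w2*w3 + w3*w1 = r" "w1*w2*w3 = f"
proof (cases "m = 0")
  case True
  then have "q = 0" "r = 0" "e = 0" "f = 0" using qr qr0 e f nz by auto
  \<comment> \<open>The instantiation follows the order \<open>z1 w1 z2 w2 z3 w3\<close>: the pairs
    are \<open>(s, 0)\<close>, \<open>(0, t)\<close>, \<open>(0, 0)\<close>, all with product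
    0.\<close>
  then show thesis using True by (intro that[of s 0 0 t 0 0]) simp_all
next
  case False
  obtain z1 z2 z3 where z: "z1 + z2 + z3 = s" "z1*z2 + z2*z3 + z3*z1 = q" "z1*z2*z3 = e"
    by (rule vieta_cubic)
  have "q \<noteq> 0" using qr nz False by auto
  then have e0: "e \<noteq> 0" using e False by auto
  have z0: "z1 \<noteq> 0" "z2 \<noteq> 0" "z3 \<noteq> 0" using z(3) e0 by auto
  define w1 w2 w3 where w: "w1 = m / z1" "w2 = m / z2" "w3 = m / z3"
  have zw: "z1*w1 = m" "z2*w2 = m" "z3*w3 = m"
    using z0 by (simp_all add: w)
  \<comment> \<open>Multiplying by \<open>e = z1*z2*z3\<close> replaces division by the products
    \<open>z1*w1\<close>, \<open>z2*w2\<close>, \<open>z3*w3\<close>, all equal to \<open>m\<close>.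
    The next two identities need the further factors \<open>t\<close> and \<open>t * s\<close> to
    bring in \<open>e * t\<close>, \<open>f * s\<close> and \<open>q * r\<close>.\<close>
  have "e * (w1 + w2 + w3) = (z1*w1) * (z2*z3) + (z2*w2) * (z3*z1) + (z3*w3) * (z1*z2)"
    unfolding z(3)[symmetric] by algebra
  also have "\<dots> = e * t" unfolding zw e z(2)[symmetric] by algebra
  finally have w1: "w1 + w2 + w3 = t" using e0 by simp
  have "e * (w1*w2 + w2*w3 + w3*w1)
      = (z1*w1)*(z2*w2) * z3 + (z2*w2)*(z3*w3) * z1 + (z3*w3)*(z1*w1) * z2"
    unfolding z(3)[symmetric] by algebra
  also have "\<dots> = m * m * s" unfolding zw z(1)[symmetric] by algebra
  finally have "(e * t) * (w1*w2 + w2*w3 + w3*w1) = (e * t) * r"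
    using e qr by algebra
  then have w2: "w1*w2 + w2*w3 + w3*w1 = r" using e0 nz by simp
  have "e * (w1*w2*w3) = (z1*w1)*(z2*w2)*(z3*w3)"
    unfolding z(3)[symmetric] by algebra
  also have "\<dots> = m * m * m" unfolding zw by simp
  finally have "(e * t * s) * (w1*w2*w3) = (e * t * s) * f"
    using e f qr by algebra
  then have w3: "w1*w2*w3 = f" using e0 nz by simp
  show thesis by (rule that[OF zw z w1 w2 w3])
qed

section \<open>A complex cuboid above a real point\<close>

lemma cuboid_preimage:
  fixes E10 E20 E30 E01 E02 E03 E21 E11 E12 L :: real
  assumes nz: "E10 \<noteq> 0 \<or> E01 \<noteq> 0"
    and surf: "4*E11^2 + E10^4 + E01^4 - 2*E10^2*E01^2 - 2*L^2*E10^2 - 6*E01^2*L^2 + L^4 = 0"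
    and E20: "E20 = 1/2*E10^2 - 1/2*L^2"
    and E02: "E02 = 1/2*E01^2 - L^2"
    and E03: "E03 = - 1/3*E21 - 1/6*E01*E10^2 - 5/6*E01*L^2 + 1/6*E01^3 + 1/3*E10*E11"
    and E30: "E30 = - 1/3*E12 - 1/6*E10*E01^2 - 1/2*E10*L^2 + 1/6*E10^3 + 1/3*E01*E11"
    and lin: "linear_system E10 E01 E11 L (E21, E12)"
  obtains X :: "xvar \<Rightarrow> complex" where
    "\<And>v. poly_subst of_rat X (phi_var v) = of_real (point E10 E20 E30 E01 E02 E03 E21 E11 E12 L v)"
proof -
  note pw = power2_eq_square power3_eq_cube power4_eq_xxxx
  define s where "s = Complex E01 E10"
  define q where "q = Complex (E02 - E20) E11"
  define e where "e = Complex (E03 - E21) (E12 - E30)"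
  \<comment> \<open>\<open>r\<close> will be \<open>z1 z2 w3 + z2 z3 w1 + z3 z1 w2\<close>\<close>
  define r where "r = Complex (3*E03 + E21) (E12 + 3*E30)"
  have lin1: "E10 * E21 + E01 * E12
      = 1/4 * E11 * E10^2 + 1/4 * E01^2 * E11 + 3/4 * E11 * L^2 - E10 * E01 * L^2"
    and lin2: "- E01 * E21 + E10 * E12
      = 1/8 * E10^4 - 1/8 * E01^4 - 3/4 * E10^2 * L^2 + E01^2 * L^2 - 3/8 * L^4"
    using lin by (simp_all add: linear_system_def)
  have s0: "s \<noteq> 0" using nz by (auto simp: s_def complex_eq_iff)
  have q: "q * cnj q = of_real (L^2) * (s * cnj s)"
    using surf unfolding q_def s_def E20 E02
    by (simp add: complex_eq_iff pw algebra_simps)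
  \<comment> \<open>The real and imaginary parts of \<open>e * cnj s = L^2 * q\<close>; after
    elimination they are 4/3 times \<open>lin2\<close> and \<open>lin1\<close> respectively.\<close>
  have "(E03 - E21) * E01 + (E12 - E30) * E10 = L^2 * (E02 - E20)"
       "(E12 - E30) * E01 - (E03 - E21) * E10 = L^2 * E11"
    using lin1 lin2 surf unfolding E20 E02 E03 E30 by (simp_all add: pw algebra_simps)
  then have e: "e * cnj s = of_real (L^2) * q"
    unfolding e_def s_def q_def by (simp add: complex_eq_iff pw algebra_simps)
  have r: "q * cnj s - 2 * of_real (L^2) * s = r"
    unfolding r_def s_def q_def E20 E02 E03 E30 by (simp add: complex_eq_iff pw algebra_simps)
  define t q' e' r' M where defs': "t = cnj s" "q' = cnj q" "e' = cnj e" "r' = cnj r"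
    "M = complex_of_real (L^2)"
  note defs = defs' s_def q_def e_def r_def
  have t0: "t \<noteq> 0" and q0: "q = 0 \<longleftrightarrow> q' = 0" using s0 by (simp_all add: defs')
  note q = q[folded defs'] and e = e[folded defs'] and r = r[folded defs']
  have f: "e' * s = M * q'" using arg_cong[OF e, of cnj] by (simp add: defs')
  obtain z1 z2 z3 w1 w2 w3 :: complex where
    zw: "z1*w1 = M" "z2*w2 = M" "z3*w3 = M"
    and z: "z1 + z2 + z3 = s" "z1*z2 + z2*z3 + z3*z1 = q" "z1*z2*z3 = e"
    and w: "w1 + w2 + w3 = t" "w1*w2 + w2*w3 + w3*w1 = q'" "w1*w2*w3 = e'"
    using reciprocal_triples[OF s0 t0 q0 q e f] by metis
  have "z1*w2 + z2*w1 + z2*w3 + z3*w2 + z3*w1 + z1*w3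
      = (z1 + z2 + z3) * (w1 + w2 + w3) - (z1*w1 + z2*w2 + z3*w3)" by algebra
  then have zw2: "z1*w2 + z2*w1 + z2*w3 + z3*w2 + z3*w1 + z1*w3 = s * t - 3 * M"
    by (simp add: zw z w)
  have "z1*z2*w3 + z2*z3*w1 + z3*z1*w2 = (z1*z2 + z2*z3 + z3*z1) * (w1 + w2 + w3)
      - ((z1*w1) * (z2 + z3) + (z2*w2) * (z3 + z1) + (z3*w3) * (z1 + z2))" by algebra
  also have "\<dots> = r" unfolding zw z w r[symmetric] unfolding z(1)[symmetric] by algebra
  finally have zzw: "z1*z2*w3 + z2*z3*w1 + z3*z1*w2 = r" .
  have r': "q' * s - 2 * M * t = r'" using arg_cong[OF r, of cnj] by (simp add: defs')
  have "w1*w2*z3 + w2*w3*z1 + w3*w1*z2 = (w1*w2 + w2*w3 + w3*w1) * (z1 + z2 + z3)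
      - ((z1*w1) * (w2 + w3) + (z2*w2) * (w3 + w1) + (z3*w3) * (w1 + w2))" by algebra
  also have "\<dots> = r'" unfolding zw z w r'[symmetric] unfolding w(1)[symmetric] by algebra
  finally have zww: "w1*w2*z3 + w2*w3*z1 + w3*w1*z2 = r'" .
  \<comment> \<open>Inverting \<open>z = d + \<i> * x\<close>, \<open>w = d - \<i> * x\<close> gives
    \<open>x = j * (z - w)\<close> with \<open>j = 1/(2*\<i>)\<close>, and
    \<open>d = h * (z + w)\<close>. In each identity below \<open>j\<close> and \<open>h\<close>
    stay symbolic during the expansion; their values enter only at the end.\<close>
  define j h where jh: "j = -\<i>/2" "h = (1/2 :: complex)"
  have v10: "j*(z1-w1) + j*(z2-w2) + j*(z3-w3) = E10" (is "?l = _")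
  proof -
    have "?l = j * (s - t)"
      unfolding z(1)[symmetric] w(1)[symmetric] by algebra
    also have "\<dots> = E10" by (simp add: jh defs complex_eq_iff pw field_simps)
    finally show ?thesis .
  qed
  have v20: "(j*(z1-w1))*(j*(z2-w2)) + (j*(z2-w2))*(j*(z3-w3)) + (j*(z3-w3))*(j*(z1-w1)) = E20"
    (is "?l = _")
  proof -
    have "?l = j^2 * (q + q' - (s * t - 3 * M))"
      unfolding z(2)[symmetric] w(2)[symmetric] zw2[symmetric] by algebra
    also have "\<dots> = E20" by (simp add: E20 E02 jh defs complex_eq_iff pw field_simps)
    finally show ?thesis .
  qed
  have v30: "(j*(z1-w1))*(j*(z2-w2))*(j*(z3-w3)) = E30" (is "?l = _")
  proof -
    have "?l = j^3 * (e - r + r' - e')"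
      unfolding z(3)[symmetric] w(3)[symmetric] zzw[symmetric] zww[symmetric] by algebra
    also have "\<dots> = E30" by (simp add: jh defs complex_eq_iff pw field_simps)
    finally show ?thesis .
  qed
  have v01: "h*(z1+w1) + h*(z2+w2) + h*(z3+w3) = E01" (is "?l = _")
  proof -
    have "?l = h * (s + t)"
      unfolding z(1)[symmetric] w(1)[symmetric] by algebra
    also have "\<dots> = E01" by (simp add: jh defs complex_eq_iff pw field_simps)
    finally show ?thesis .
  qed
  have v02: "(h*(z1+w1))*(h*(z2+w2)) + (h*(z2+w2))*(h*(z3+w3)) + (h*(z3+w3))*(h*(z1+w1)) = E02"
    (is "?l = _")
  proof -
    have "?l = h^2 * (q + q' + (s * t - 3 * M))"
      unfolding z(2)[symmetric] w(2)[symmetric] zw2[symmetric] by algebra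
    also have "\<dots> = E02" by (simp add: E20 E02 jh defs complex_eq_iff pw field_simps)
    finally show ?thesis .
  qed
  have v03: "(h*(z1+w1))*(h*(z2+w2))*(h*(z3+w3)) = E03" (is "?l = _")
  proof -
    have "?l = h^3 * (e + r + r' + e')"
      unfolding z(3)[symmetric] w(3)[symmetric] zzw[symmetric] zww[symmetric] by algebra
    also have "\<dots> = E03" by (simp add: jh defs complex_eq_iff pw field_simps)
    finally show ?thesis .
  qed
  have v21: "(j*(z1-w1))*(j*(z2-w2))*(h*(z3+w3)) + (j*(z2-w2))*(j*(z3-w3))*(h*(z1+w1))
      + (j*(z3-w3))*(j*(z1-w1))*(h*(z2+w2)) = E21"
    (is "?l = _")
  proof -
    \<comment> \<open>A monomial such as \<open>z1*z2*w3\<close> occurs once with plus and twice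
      with minus, whence \<open>- r\<close>; \<open>z1*z2*z3\<close> occurs three times with
      plus.\<close>
    have "?l = j^2 * h * (3*e - r - r' + 3*e')"
      unfolding z(3)[symmetric] w(3)[symmetric] zzw[symmetric] zww[symmetric] by algebra
    also have "\<dots> = E21" by (simp add: jh defs complex_eq_iff pw field_simps)
    finally show ?thesis .
  qed
  have v11: "(j*(z1-w1))*(h*(z2+w2)) + (h*(z1+w1))*(j*(z2-w2)) + (j*(z2-w2))*(h*(z3+w3)) + (h*(z2+w2))*(j*(z3-w3))
      + (j*(z3-w3))*(h*(z1+w1)) + (h*(z3+w3))*(j*(z1-w1)) = E11" (is "?l = _")
  proof -
    have "?l = 2 * j * h * (q - q')"
      unfolding z(2)[symmetric] w(2)[symmetric] by algebra
    also have "\<dots> = E11" by (simp add: jh defs complex_eq_iff pw field_simps)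
    finally show ?thesis .
  qed
  have v12: "(j*(z1-w1))*(h*(z2+w2))*(h*(z3+w3)) + (j*(z2-w2))*(h*(z3+w3))*(h*(z1+w1))
      + (j*(z3-w3))*(h*(z1+w1))*(h*(z2+w2)) = E12"
    (is "?l = _")
  proof -
    have "?l = j * h^2 * (3*e + r - r' - 3*e')"
      unfolding z(3)[symmetric] w(3)[symmetric] zzw[symmetric] zww[symmetric] by algebra
    also have "\<dots> = E12" by (simp add: jh defs complex_eq_iff pw field_simps)
    finally show ?thesis .
  qed
  define X where "X = (\<lambda>v. case v of X1 \<Rightarrow> j*(z1-w1) | X2 \<Rightarrow> j*(z2-w2) | X3 \<Rightarrow> j*(z3-w3)
    | D1 \<Rightarrow> h*(z1+w1) | D2 \<Rightarrow> h*(z2+w2) | D3 \<Rightarrow> h*(z3+w3) | XL \<Rightarrow> of_real L)"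
  have X: "X X1 = j*(z1-w1)" "X X2 = j*(z2-w2)" "X X3 = j*(z3-w3)"
    "X D1 = h*(z1+w1)" "X D2 = h*(z2+w2)" "X D3 = h*(z3+w3)" "X XL = of_real L"
    by (simp_all add: X_def)
  show thesis
  proof (rule that[of X])
    fix v
    show "poly_subst of_rat X (phi_var v) = of_real (point E10 E20 E30 E01 E02 E03 E21 E11 E12 L v)"
      by (cases v) (simp_all only: phi_var.simps point.simps poly_subst_add poly_subst_mult
        poly_subst_Var of_rat_add of_rat_mult of_rat_0 of_rat_1 X v10 v20 v30 v01 v02 v03 v21 v11 v12)
  qed
qed

section \<open>The linear system and the equivalence\<close>

text \<open>The determinant is \<open>E10^2 + E01^2\<close>, nonzero over the reals; Cramer's rule
  gives the solution.\<close>

lemma linear_system_unique_solution: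
  assumes "E10 \<noteq> 0 \<or> E01 \<noteq> 0"
  shows "\<exists>!s. linear_system E10 E01 E11 L s"
proof -
  define R S where RS:
    "R = 1/4 * E11 * E10^2 + 1/4 * E01^2 * E11 + 3/4 * E11 * L^2 - E10 * E01 * L^2"
    "S = 1/8 * E10^4 - 1/8 * E01^4 - 3/4 * E10^2 * L^2 + E01^2 * L^2 - 3/8 * L^4"
  define D where "D = E10^2 + E01^2"
  have D: "D \<noteq> 0" using assms by (simp add: D_def sum_power2_eq_zero_iff)
  have "linear_system E10 E01 E11 L (u, v) \<longleftrightarrow>
      (u, v) = ((E10*R - E01*S) / D, (E01*R + E10*S) / D)" for u v
  proof -
    have "linear_system E10 E01 E11 L (u, v) \<longleftrightarrow> E10*u + E01*v = R \<and> - E01*u + E10*v = S"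
      by (simp add: linear_system_def RS)
    also have "\<dots> \<longleftrightarrow> u * D = E10*R - E01*S \<and> v * D = E01*R + E10*S"
    proof safe
      assume "u * D = E10*R - E01*S" "v * D = E01*R + E10*S"
      then have "(E10*u + E01*v) * D = R * D" "(- E01*u + E10*v) * D = S * D"
        unfolding D_def by algebra+
      then show "E10*u + E01*v = R" "- E01*u + E10*v = S" using D by simp_all
    qed (simp_all add: D_def algebra_simps power2_eq_square)
    finally show ?thesis using D by (simp add: eq_divide_eq)
  qed
  then show ?thesis by (metis surj_pair)
qed

theorem theorem5p1:
  fixes E10 E20 E30 E01 E02 E03 E21 E11 E12 L :: real
  assumes "E10 \<noteq> 0 \<or> E01 \<noteq> 0"
  shows "(\<exists>!s. linear_system E10 E01 E11 L s) \<and>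
    ((E10^2 - 2*E20 - L^2 = 0 \<and>
      2*E02 - 4*E20 - E01^2 + 2*E10^2 = 0 \<and>
      E10*E11 - 3*E03 - E21 + 3*E01*E02 - E20*E01 - E01^3 = 0 \<and>
      E01*E11 - E12 - 3*E30 + E10*E02 + E20*E10 - E01^2*E10 = 0 \<and>
      - E10*E21 - E01*E12 - E01*E30 - E01^3*E10 + E01^2*E11 - E02*E11 + E11*E20
        - E10*E03 + 2*E10*E01*E02 = 0 \<and>
      4*E01*E10*E11 - 3*E01^2*E10^2 + 2*E10^2*E02 + 2*E20*E01^2 - 2*E10*E12 - 2*E02*E20
        - 2*E01*E21 - E11^2 - 12*E10*E30 + 6*E20^2 = 0 \<and>
      4*E01*E10*E11 - 4*E10^2*E02 - 4*E20*E01^2 - 2*E10*E12 + 10*E02*E20 - 2*E01*E21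
        - E11^2 - 12*E01*E03 - 3*E01^4 - 6*E02^2 + 12*E01^2*E02 = 0 \<and>
      9*E01*E03*E20 - 7*E01^2*E02*E20 + 2*E02*E10*E12 - 2*E01^2*E10*E12 + 3*E03*E10*E11
        + 4*E01^3*E10*E11 - 7*E01*E02*E10*E11 - 6*E01*E03*E10^2 + 8*E01^2*E02*E10^2
        + 3*E01*E11*E30 - 2*E01*E20*E21 + E10*E12*E20 - E02*E10^2*E20 + E01*E10*E11*E20
        + 9*E02*E10*E30 - 2*E02*E20^2 + 2*E01^2*E20^2 - E11^2*E20 - 3*E12*E30 + E02*E11^2
        - E01^2*E11^2 - 2*E02^2*E10^2 + 2*E01^4*E20 + 2*E02^2*E20 - 3*E03*E21
        - 2*E01^3*E21 + 5*E01*E02*E21 - 6*E01^2*E10*E30 - 3*E01^4*E10^2 = 0 \<and>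
      (\<forall>q\<in>K. eval_at (point E10 E20 E30 E01 E02 E03 E21 E11 E12 L) q = 0))
    \<longleftrightarrow>
     (4*E11^2 + E10^4 + E01^4 - 2*E10^2*E01^2 - 2*L^2*E10^2 - 6*E01^2*L^2 + L^4 = 0 \<and>
      E20 = 1/2*E10^2 - 1/2*L^2 \<and>
      E02 = 1/2*E01^2 - L^2 \<and>
      E03 = - 1/3*E21 - 1/6*E01*E10^2 - 5/6*E01*L^2 + 1/6*E01^3 + 1/3*E10*E11 \<and>
      E30 = - 1/3*E12 - 1/6*E10*E01^2 - 1/2*E10*L^2 + 1/6*E10^3 + 1/3*E01*E11 \<and>
      linear_system E10 E01 E11 L (E21, E12)))"
  (is "_ \<and> (?sys \<longleftrightarrow> ?res)")
proof (rule conjI[OF _ iffI])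
  show "\<exists>!s. linear_system E10 E01 E11 L s"
    by (rule linear_system_unique_solution[OF assms])
next
  note pw = power2_eq_square power3_eq_cube power4_eq_xxxx
  assume sys: ?sys
  have E20: "E20 = 1/2*E10^2 - 1/2*L^2" using sys by simp
  have E02: "E02 = 1/2*E01^2 - L^2" using sys by simp
  have "E10*E11 - 3*E03 - E21 + 3*E01*E02 - E20*E01 - E01^3 = 0" using sys by blast
  then have E03: "E03 = - 1/3*E21 - 1/6*E01*E10^2 - 5/6*E01*L^2 + 1/6*E01^3 + 1/3*E10*E11"
    unfolding E20 E02 by (simp add: algebra_simps pw)
  have "E01*E11 - E12 - 3*E30 + E10*E02 + E20*E10 - E01^2*E10 = 0" using sys by blast
  then have E30: "E30 = - 1/3*E12 - 1/6*E10*E01^2 - 1/2*E10*L^2 + 1/6*E10^3 + 1/3*E01*E11"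
    unfolding E20 E02 by (simp add: algebra_simps pw)
  have e5: "- E10*E21 - E01*E12 - E01*E30 - E01^3*E10 + E01^2*E11 - E02*E11 + E11*E20
      - E10*E03 + 2*E10*E01*E02 = 0" using sys by blast
  have e6: "4*E01*E10*E11 - 3*E01^2*E10^2 + 2*E10^2*E02 + 2*E20*E01^2 - 2*E10*E12 - 2*E02*E20
      - 2*E01*E21 - E11^2 - 12*E10*E30 + 6*E20^2 = 0" using sys by blast
  have e7: "4*E01*E10*E11 - 4*E10^2*E02 - 4*E20*E01^2 - 2*E10*E12 + 10*E02*E20 - 2*E01*E21
      - E11^2 - 12*E01*E03 - 3*E01^4 - 6*E02^2 + 12*E01^2*E02 = 0" using sys by blast
  have "4*E11^2 + E10^4 + E01^4 - 2*E10^2*E01^2 - 2*L^2*E10^2 - 6*E01^2*L^2 + L^4 = 0"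
    using e6 e7 unfolding E20 E02 E03 E30 by (simp add: algebra_simps pw)
  moreover have "E10 * E21 + E01 * E12
      = 1/4 * E11 * E10^2 + 1/4 * E01^2 * E11 + 3/4 * E11 * L^2 - E10 * E01 * L^2"
    using e5 unfolding E20 E02 E03 E30 by (simp add: algebra_simps pw)
  \<comment> \<open>In the difference of \<open>e6\<close> and \<open>e7\<close> the term
    \<open>E11^2\<close> cancels, leaving 4 times this relation.\<close>
  moreover have "- E01 * E21 + E10 * E12
      = 1/8 * E10^4 - 1/8 * E01^4 - 3/4 * E10^2 * L^2 + E01^2 * L^2 - 3/8 * L^4"
    using e6 e7 unfolding E20 E02 E03 E30 by (simp add: algebra_simps pw)
  ultimately show ?res using E20 E02 E03 E30 by (simp add: linear_system_def)
next
  note pw = power2_eq_square power3_eq_cube power4_eq_xxxx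
  assume ?res
  then have surf: "4*E11^2 + E10^4 + E01^4 - 2*E10^2*E01^2 - 2*L^2*E10^2 - 6*E01^2*L^2 + L^4 = 0"
    and E20: "E20 = 1/2*E10^2 - 1/2*L^2"
    and E02: "E02 = 1/2*E01^2 - L^2"
    and E03: "E03 = - 1/3*E21 - 1/6*E01*E10^2 - 5/6*E01*L^2 + 1/6*E01^3 + 1/3*E10*E11"
    and E30: "E30 = - 1/3*E12 - 1/6*E10*E01^2 - 1/2*E10*L^2 + 1/6*E10^3 + 1/3*E01*E11"
    and lin: "linear_system E10 E01 E11 L (E21, E12)"
    by blast+
  have lin1: "E10 * E21 + E01 * E12
      = 1/4 * E11 * E10^2 + 1/4 * E01^2 * E11 + 3/4 * E11 * L^2 - E10 * E01 * L^2"
    and lin2: "- E01 * E21 + E10 * E12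
      = 1/8 * E10^4 - 1/8 * E01^4 - 3/4 * E10^2 * L^2 + E01^2 * L^2 - 3/8 * L^4"
    using lin by (simp_all add: linear_system_def)
  have ker: "\<forall>q\<in>K. eval_at (point E10 E20 E30 E01 E02 E03 E21 E11 E12 L) q = 0"
    using cuboid_preimage[OF assms surf E20 E02 E03 E30 lin] kernel_vanishes_at_image by metis
  \<comment> \<open>Modulo the linear relations the eighth polynomial is still quadratic in \<open>E21\<close> and \<open>E12\<close>,
    through \<open>E21\<^sup>2 + E12\<^sup>2\<close>; the factor below makes the linear system applicable to it.\<close>
  have "(E10^2 + E01^2) *
     (9*E01*E03*E20 - 7*E01^2*E02*E20 + 2*E02*E10*E12 - 2*E01^2*E10*E12 + 3*E03*E10*E11
        + 4*E01^3*E10*E11 - 7*E01*E02*E10*E11 - 6*E01*E03*E10^2 + 8*E01^2*E02*E10^2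
        + 3*E01*E11*E30 - 2*E01*E20*E21 + E10*E12*E20 - E02*E10^2*E20 + E01*E10*E11*E20
        + 9*E02*E10*E30 - 2*E02*E20^2 + 2*E01^2*E20^2 - E11^2*E20 - 3*E12*E30 + E02*E11^2
        - E01^2*E11^2 - 2*E02^2*E10^2 + 2*E01^4*E20 + 2*E02^2*E20 - 3*E03*E21
        - 2*E01^3*E21 + 5*E01*E02*E21 - 6*E01^2*E10*E30 - 3*E01^4*E10^2) = 0"
    using lin1 lin2 surf unfolding E20 E02 E03 E30 by algebra
  moreover have "E10^2 + E01^2 \<noteq> 0" using assms by (simp add: sum_power2_eq_zero_iff)
  ultimately have e8:
    "9*E01*E03*E20 - 7*E01^2*E02*E20 + 2*E02*E10*E12 - 2*E01^2*E10*E12 + 3*E03*E10*E11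
        + 4*E01^3*E10*E11 - 7*E01*E02*E10*E11 - 6*E01*E03*E10^2 + 8*E01^2*E02*E10^2
        + 3*E01*E11*E30 - 2*E01*E20*E21 + E10*E12*E20 - E02*E10^2*E20 + E01*E10*E11*E20
        + 9*E02*E10*E30 - 2*E02*E20^2 + 2*E01^2*E20^2 - E11^2*E20 - 3*E12*E30 + E02*E11^2
        - E01^2*E11^2 - 2*E02^2*E10^2 + 2*E01^4*E20 + 2*E02^2*E20 - 3*E03*E21
        - 2*E01^3*E21 + 5*E01*E02*E21 - 6*E01^2*E10*E30 - 3*E01^4*E10^2 = 0"
    using mult_eq_0_iff by blast
  \<comment> \<open>The first four equations restate the formulas for \<open>E20\<close>,
    \<open>E02\<close>, \<open>E03\<close>, \<open>E30\<close>; the fifth is a multiple of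
    \<open>lin1\<close>, and the sixth and seventh are combinations of \<open>lin2\<close> and
    \<open>surf\<close>.\<close>
  show ?sys
    by (intro conjI e8 ker)
      (use lin1 lin2 surf in \<open>simp_all add: E20 E02 E03 E30 pw algebra_simps\<close>)
qed

end
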